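(* Let $x$ be a real number with $x>1/3$ and let $z\in\mathbb{C}$ satisfy $|z|>|\lambda_1(x)|$, where $\lambda_1(x)=3x+\sqrt{9x^2-1}$. Then $$\sum_{n=0}^\infty \frac{1}{4n+3}\frac{B_{4n+3}(x)}{z^{4n+3}} = \frac{1}{8\sqrt{9x^2-1}}\ln\Big (\frac{z^2+2\sqrt{9x^2-1}\,z-1}{z^2-2\sqrt{9x^2-1}\,z-1}\Big ) - \frac{1}{4\sqrt{9x^2-1}}\arctan\Big (\frac{2\sqrt{9x^2-1}\,z}{z^2+1}\Big )$$ and $$\sum_{n=0}^\infty \frac{1}{4n+3}\frac{C_{4n+3}(x)}{z^{4n+3}} = \frac{1}{8}\ln\Big (\frac{z^2+6xz+1}{z^2-6xz+1}\Big ) - \frac{1}{4}\arctan\Big (\frac{6xz}{z^2-1}\Big ).$$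
   Context: The balancing polynomials $(B_n(x))_{n\ge 0}$ and Lucas-balancing polynomials $(C_n(x))_{n\ge 0}$ both satisfy the recurrence $u_n(x)=6x\,u_{n-1}(x)-u_{n-2}(x)$ for $n\ge 2$, with initial terms $B_0(x)=0$, $B_1(x)=1$ and $C_0(x)=1$, $C_1(x)=3x$. Here $\ln$ and $\arctan$ denote the principal branches of the (complex) logarithm and arctangent. *)

theory Defs
  imports "HOL-Analysis.Analysis" "HOL-Computational_Algebra.Polynomial"
begin

fun balancing_poly :: "nat \<Rightarrow> 'a::comm_ring_1 poly" where
  "balancing_poly 0 = 0"
| "balancing_poly (Suc 0) = 1"
| "balancing_poly (Suc (Suc n)) = [:0, 6:] * balancing_poly (Suc n) - balancing_poly n"

fun lucas_balancing_poly :: "nat \<Rightarrow> 'a::comm_ring_1 poly" where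
  "lucas_balancing_poly 0 = 1"
| "lucas_balancing_poly (Suc 0) = [:0, 3:]"
| "lucas_balancing_poly (Suc (Suc n)) =
     [:0, 6:] * lucas_balancing_poly (Suc n) - lucas_balancing_poly n"

text \<open>For $x > 1/3$: the larger root of the characteristic polynomial $t^2 - 6xt + 1$.\<close>

definition balancing_root :: "real \<Rightarrow> real" where
  "balancing_root x = 3 * x + sqrt (9 * x\<^sup>2 - 1)"

end

theory Submission
  imports Defs
begin

text \<open>
  By the Binet formulas both sums are linear combinations of $\sum_n y^{4n+3}/(4n+3)
  = (\mathrm{artanh}\, y - \arctan y)/2$ at $y = \lambda_1/z$ and $y = \lambda_2/z$, where
  $\lambda_1 \lambda_2 = 1$. For $|y| < 1$ the Moebius image $(1+y)/(1-y)$ lies in the right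
  half-plane, so its argument is less than $\pi/2$ in modulus; hence the addition theorems of
  artanh and arctan at two such points hold for the principal branches without correction.
\<close>

section \<open>Moebius images of the unit disc and the principal logarithm\<close>

lemma Re_moebius_disc_pos:
  fixes y :: complex
  assumes "norm y < 1"
  shows "0 < Re ((1 + y) / (1 - y))"
proof -
  have "(norm y)\<^sup>2 < 1"
    using assms by (simp add: power_less_one_iff abs_square_less_1)
  hence lt: "(Re y)\<^sup>2 + (Im y)\<^sup>2 < 1"
    by (simp add: cmod_power2)
  have "1 - y \<noteq> 0"
    using assms by auto
  hence "(norm (1 - y))\<^sup>2 > 0"
    by simp
  hence den: "(1 - Re y)\<^sup>2 + (Im y)\<^sup>2 > 0"
    by (simp add: cmod_power2)
  \<comment> \<open>Expanding by the conjugate of the denominator gives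
    \<open>(1 - |y|^2) / |1 - y|^2\<close>, so only the two squared norms matter.\<close>
  have "Re ((1 + y) / (1 - y)) = (1 - ((Re y)\<^sup>2 + (Im y)\<^sup>2)) / ((1 - Re y)\<^sup>2 + (Im y)\<^sup>2)"
    by (simp add: Re_divide power2_eq_square algebra_simps)
  thus ?thesis
    using lt den by simp
qed

lemma Ln_moebius_minus:
  fixes y :: complex
  assumes "norm y < 1"
  shows "Ln ((1 - y) / (1 + y)) = - Ln ((1 + y) / (1 - y))"
proof -
  have "(1 + y) / (1 - y) \<notin> \<real>\<^sub>\<le>\<^sub>0"
    using Re_moebius_disc_pos[OF assms] by (auto simp: complex_nonpos_Reals_iff)
  from Ln_inverse[OF this] show ?thesis
    by simp
qed

text \<open>Both arguments are below \<open>pi / 2\<close> in modulus, so their sum stays strictly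
  between \<open>- pi\<close> and \<open>pi\<close> and no multiple of \<open>2 * pi * \<i>\<close>
  appears.\<close>

lemma Ln_mult_Re_pos:
  assumes "0 < Re u" "0 < Re v"
  shows "Ln (u * v) = Ln u + Ln v"
proof -
  have nz: "u \<noteq> 0" "v \<noteq> 0"
    using assms by auto
  have "\<bar>Im (Ln u)\<bar> < pi / 2" "\<bar>Im (Ln v)\<bar> < pi / 2"
    using assms nz Re_Ln_pos_lt by blast+
  thus ?thesis
    using nz by (intro Ln_times_simple) auto
qed

text \<open>This is twice the addition theorem of artanh, kept as a single quotient so that its
  polynomial form in \<open>z\<close> can be read off later.\<close>

lemma Ln_moebius_add:
  fixes a b :: complex
  assumes "norm a < 1" "norm b < 1"
  shows "Ln ((1 + a) / (1 - a)) + Ln ((1 + b) / (1 - b))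
       = Ln (((1 + a) * (1 + b)) / ((1 - a) * (1 - b)))"
  using Ln_mult_Re_pos[OF assms[THEN Re_moebius_disc_pos]] by simp

section \<open>Oddness and addition theorem of the principal arctangent\<close>

lemma Arctan_minus_disc:
  assumes "norm y < 1"
  shows "Arctan (- y) = - Arctan y"
  using Ln_moebius_minus[of "\<i> * y"] assms by (simp add: Arctan_def norm_mult)

text \<open>The logarithm in the definition of \<open>Arctan\<close> is taken at a Moebius image of
  \<open>- \<i> * y\<close>, so \<open>Ln_moebius_add\<close> applies. The combined argument may
  itself lie outside the unit disc.\<close>

lemma Arctan_add_disc:
  assumes "norm a < 1" "norm b < 1"
  shows "Arctan a + Arctan b = Arctan ((a + b) / (1 - a * b))"
proof -
  have "norm (a * b) < 1"
    using assms mult_right_le_one_le[of "norm a" "norm b"] by (simp add: norm_mult)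
  hence nz: "1 - a * b \<noteq> 0"
    by auto
  \<comment> \<open>Numerator and denominator share the factor \<open>1 / (1 - a * b)\<close>, which
    cancels in the quotient under \<open>Ln\<close>.\<close>
  have num: "1 - \<i> * ((a + b) / (1 - a * b)) = (1 - \<i> * a) * (1 - \<i> * b) / (1 - a * b)"
    and den: "1 + \<i> * ((a + b) / (1 - a * b)) = (1 + \<i> * a) * (1 + \<i> * b) / (1 - a * b)"
    using nz by (simp_all add: field_simps)
  have "Arctan a + Arctan b =
      \<i> / 2 * (Ln ((1 - \<i> * a) / (1 + \<i> * a)) + Ln ((1 - \<i> * b) / (1 + \<i> * b)))"
    by (simp add: Arctan_def algebra_simps)
  also have "\<dots> = \<i> / 2 * Ln ((1 - \<i> * a) * (1 - \<i> * b) / ((1 + \<i> * a) * (1 + \<i> * b)))"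
    using Ln_moebius_add[of "- (\<i> * a)" "- (\<i> * b)"] assms by (simp add: norm_mult)
  also have "\<dots> = Arctan ((a + b) / (1 - a * b))"
    unfolding Arctan_def num den using nz by simp
  finally show ?thesis .
qed

section \<open>The power series over exponents congruent to 3 modulo 4\<close>

lemma sums_power_4n_plus_3:
  fixes y :: complex
  assumes "norm y < 1"
  shows "(\<lambda>n. y ^ (4 * n + 3) / of_nat (4 * n + 3)) sums
    (1 / 4 * Ln ((1 + y) / (1 - y)) - 1 / 2 * Arctan y)"
proof -
  \<comment> \<open>Half the difference of the artanh and arctan terms. The factor
    \<open>(1 - (-1) ^ k) / 2\<close> is 1 for odd \<open>k\<close> and 0 for even \<open>k\<close>;
    for \<open>k = 2 * n + 1\<close> the exponent \<open>2 * k + 1\<close> is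
    \<open>4 * n + 3\<close>.\<close>
  define h where "h = (\<lambda>k. (1 - (-1) ^ k) / 2 * (y ^ (2 * k + 1) / of_nat (2 * k + 1)))"
  have arctan: "(\<lambda>k. (-1) ^ k / of_nat (2 * k + 1) * y ^ (2 * k + 1)) sums Arctan y"
    using Arctan_series(2)[of y] assms by simp
  \<comment> \<open>The artanh series comes from the arctan series by artanh y =
    \<open>- \<i> * Arctan (\<i> * y)\<close>: the powers of \<open>\<i>\<close> cancel the
    alternating signs.\<close>
  have "(\<lambda>k. (-1) ^ k / of_nat (2 * k + 1) * (\<i> * y) ^ (2 * k + 1)) sums Arctan (\<i> * y)"
    using Arctan_series(2)[of "\<i> * y"] assms by (simp add: norm_mult)
  hence "(\<lambda>k. - \<i> * ((-1) ^ k / of_nat (2 * k + 1) * (\<i> * y) ^ (2 * k + 1))) sums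
      (- \<i> * Arctan (\<i> * y))"
    by (rule sums_mult)
  moreover have "- \<i> * ((-1) ^ k / of_nat (2 * k + 1) * (\<i> * y) ^ (2 * k + 1)) =
      y ^ (2 * k + 1) / of_nat (2 * k + 1)" for k
  proof -
    have "\<i> ^ (2 * k + 1) = \<i> * (-1) ^ k"
      by (simp add: power_mult)
    hence "- \<i> * (-1) ^ k * (\<i> * y) ^ (2 * k + 1) =
        - (\<i> * \<i>) * ((-1) ^ k * (-1) ^ k) * y ^ (2 * k + 1)"
      unfolding power_mult_distrib by (simp only: mult_minus_left mult_minus_right mult_ac)
    also have "\<dots> = y ^ (2 * k + 1)"
      by (simp flip: power_mult_distrib)
    finally show ?thesis
      by (metis (no_types, lifting) mult.assoc times_divide_eq_left times_divide_eq_right)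
  qed
  moreover have "- \<i> * Arctan (\<i> * y) = 1 / 2 * Ln ((1 + y) / (1 - y))"
    by (simp add: Arctan_def flip: mult.assoc)
  ultimately have "(\<lambda>k. y ^ (2 * k + 1) / of_nat (2 * k + 1)) sums (1 / 2 * Ln ((1 + y) / (1 - y)))"
    by (simp only:)
  from sums_mult[OF sums_diff[OF this arctan], of "1 / 2"]
  have "h sums (1 / 4 * Ln ((1 + y) / (1 - y)) - 1 / 2 * Arctan y)"
    by (simp add: h_def diff_divide_distrib algebra_simps)
  moreover have "h k = 0" if "k \<notin> range (\<lambda>n. 2 * n + 1)" for k
  proof -
    have "even k"
      using that by (metis oddE rangeI)
    thus ?thesis
      by (simp add: h_def)
  qed
  ultimately have "(\<lambda>n. h (2 * n + 1)) sums (1 / 4 * Ln ((1 + y) / (1 - y)) - 1 / 2 * Arctan y)"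
    by (subst sums_mono_reindex) (auto simp: strict_mono_def)
  moreover have "h (2 * n + 1) = y ^ (4 * n + 3) / of_nat (4 * n + 3)" for n
  proof -
    have "2 * (2 * n + 1) + 1 = 4 * n + 3"
      by simp
    thus ?thesis
      unfolding h_def by (simp only:) simp
  qed
  ultimately show ?thesis
    by (simp only:)
qed

section \<open>Binet formulas from the roots of the characteristic polynomial\<close>

lemma char_root_power_recurrence:
  fixes r x :: real
  assumes "r\<^sup>2 = 6 * x * r - 1"
  shows "r ^ Suc (Suc n) = 6 * x * r ^ Suc n - r ^ n"
proof -
  have "r ^ Suc (Suc n) = r ^ n * r\<^sup>2"
    by (simp add: power2_eq_square)
  thus ?thesis
    unfolding assms by (simp add: right_diff_distrib)
qed

lemma balancing_poly_Binet:
  fixes x s :: real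
  assumes "s\<^sup>2 = 9 * x\<^sup>2 - 1"
  shows "2 * s * poly (balancing_poly n) x = (3 * x + s) ^ n - (3 * x - s) ^ n"
proof (induction n rule: balancing_poly.induct)
  case (3 n)
  have roots: "(3 * x + s)\<^sup>2 = 6 * x * (3 * x + s) - 1" "(3 * x - s)\<^sup>2 = 6 * x * (3 * x - s) - 1"
    using assms by (simp_all add: power2_eq_square algebra_simps)
  have "2 * s * poly (balancing_poly (Suc (Suc n))) x =
      6 * x * (2 * s * poly (balancing_poly (Suc n)) x) - 2 * s * poly (balancing_poly n) x"
    by (simp add: algebra_simps)
  thus ?case
    \<comment> \<open>Both sides now satisfy the same linear recurrence, so the two induction
      hypotheses finish the step.\<close>
    unfolding 3 roots[THEN char_root_power_recurrence]
    by (simp add: algebra_simps del: power_Suc balancing_poly.simps)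
qed simp_all

lemma lucas_balancing_poly_Binet:
  fixes x s :: real
  assumes "s\<^sup>2 = 9 * x\<^sup>2 - 1"
  shows "2 * poly (lucas_balancing_poly n) x = (3 * x + s) ^ n + (3 * x - s) ^ n"
proof (induction n rule: lucas_balancing_poly.induct)
  case (3 n)
  have roots: "(3 * x + s)\<^sup>2 = 6 * x * (3 * x + s) - 1" "(3 * x - s)\<^sup>2 = 6 * x * (3 * x - s) - 1"
    using assms by (simp_all add: power2_eq_square algebra_simps)
  have "2 * poly (lucas_balancing_poly (Suc (Suc n))) x =
      6 * x * (2 * poly (lucas_balancing_poly (Suc n)) x) - 2 * poly (lucas_balancing_poly n) x"
    by (simp add: algebra_simps)
  thus ?case
    unfolding 3 roots[THEN char_root_power_recurrence]
    by (simp add: algebra_simps del: power_Suc lucas_balancing_poly.simps)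
qed simp_all

section \<open>Evaluation of the series at the two scaled roots\<close>

theorem theorem8:
  fixes x :: real and z :: complex
  assumes "x > 1 / 3"
    and "norm z > \<bar>balancing_root x\<bar>"
  shows "((\<lambda>n. 1 / of_nat (4 * n + 3) *
            (complex_of_real (poly (balancing_poly (4 * n + 3)) x) / z ^ (4 * n + 3)))
          sums
          (1 / (8 * complex_of_real (sqrt (9 * x\<^sup>2 - 1))) *
             Ln ((z\<^sup>2 + 2 * complex_of_real (sqrt (9 * x\<^sup>2 - 1)) * z - 1) /
                 (z\<^sup>2 - 2 * complex_of_real (sqrt (9 * x\<^sup>2 - 1)) * z - 1))
           - 1 / (4 * complex_of_real (sqrt (9 * x\<^sup>2 - 1))) *
             Arctan (2 * complex_of_real (sqrt (9 * x\<^sup>2 - 1)) * z / (z\<^sup>2 + 1))))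
       \<and> ((\<lambda>n. 1 / of_nat (4 * n + 3) *
            (complex_of_real (poly (lucas_balancing_poly (4 * n + 3)) x) / z ^ (4 * n + 3)))
          sums
          (1 / 8 * Ln ((z\<^sup>2 + 6 * complex_of_real x * z + 1) /
                       (z\<^sup>2 - 6 * complex_of_real x * z + 1))
           - 1 / 4 * Arctan (6 * complex_of_real x * z / (z\<^sup>2 - 1))))"
proof -
  define s where "s = sqrt (9 * x\<^sup>2 - 1)"
  define a b where "a = of_real (3 * x + s) / z" and "b = of_real (3 * x - s) / z"
  have "(1 / 3)\<^sup>2 < x\<^sup>2"
    using assms(1) by (intro power_strict_mono) auto
  hence pos: "9 * x\<^sup>2 - 1 > 0"
    by (simp add: power2_eq_square)
  hence s: "s > 0" and s2: "s\<^sup>2 = 9 * x\<^sup>2 - 1"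
    by (simp_all add: s_def)
  have abs_root: "\<bar>3 * x + s\<bar> = 3 * x + s"
    using assms(1) s by simp
  hence "3 * x + s < norm z"
    using assms(2) by (simp add: balancing_root_def s_def)
  \<comment> \<open>Since \<open>x\<close> and \<open>s\<close> are positive, the conjugate root
    \<open>3 * x - s\<close> is smaller in modulus than \<open>3 * x + s\<close>, so one bound on
    \<open>z\<close> puts both \<open>a\<close> and \<open>b\<close> in the unit disc.\<close>
  hence bounds: "\<bar>3 * x + s\<bar> < norm z" "\<bar>3 * x - s\<bar> < norm z" and z: "z \<noteq> 0"
    using assms(1) s by (auto simp: abs_if)
  have na: "norm a < 1" and nb: "norm b < 1"
    unfolding a_def b_def norm_divide norm_of_real using bounds z by simp_all
  have ab: "a * b = 1 / z\<^sup>2"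
  proof -
    have "(3 * x + s) * (3 * x - s) = 1"
      using s2 by (simp add: power2_eq_square algebra_simps)
    hence "complex_of_real (3 * x + s) * of_real (3 * x - s) = 1"
      by (metis of_real_mult of_real_1)
    thus ?thesis
      by (simp add: a_def b_def power2_eq_square)
  qed
  have diff: "a - b = 2 * of_real s / z" and add: "a + b = 6 * of_real x / z"
    by (simp_all add: a_def b_def flip: add_divide_distrib diff_divide_distrib)

  \<comment> \<open>Differences are treated as sums at \<open>a\<close> and \<open>- b\<close>,
    using that artanh and arctan are odd on the disc.\<close>
  have nb': "norm (- b) < 1"
    using nb by simp
  have "Ln ((1 + a) / (1 - a)) - Ln ((1 + b) / (1 - b)) =
      Ln (((1 + a) * (1 - b)) / ((1 - a) * (1 + b)))"
    using Ln_moebius_add[OF na nb'] Ln_moebius_minus[OF nb] by simp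
  also have "((1 + a) * (1 - b)) / ((1 - a) * (1 + b)) =
      (1 + (a - b) - a * b) / (1 - (a - b) - a * b)"
    by (simp add: algebra_simps)
  \<comment> \<open>Scaling by the square of \<open>z\<close> clears all denominators, because the
    roots multiply to 1 and hence \<open>a * b\<close> becomes 1.\<close>
  also have "\<dots> = (z\<^sup>2 * (1 + (a - b) - a * b)) / (z\<^sup>2 * (1 - (a - b) - a * b))"
    using z by simp
  also have "\<dots> = (z\<^sup>2 + 2 * of_real s * z - 1) / (z\<^sup>2 - 2 * of_real s * z - 1)"
    unfolding ab diff using z by (simp add: algebra_simps power2_eq_square)
  finally have Ln_diff: "Ln ((1 + a) / (1 - a)) - Ln ((1 + b) / (1 - b)) =
      Ln ((z\<^sup>2 + 2 * of_real s * z - 1) / (z\<^sup>2 - 2 * of_real s * z - 1))" .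

  have "Arctan a - Arctan b = Arctan ((a - b) / (1 + a * b))"
    using Arctan_add_disc[OF na nb'] Arctan_minus_disc[OF nb] by simp
  also have "(a - b) / (1 + a * b) = (z\<^sup>2 * (a - b)) / (z\<^sup>2 * (1 + a * b))"
    using z by simp
  also have "\<dots> = 2 * of_real s * z / (z\<^sup>2 + 1)"
    unfolding ab diff using z by (simp add: algebra_simps power2_eq_square)
  finally have Arctan_diff: "Arctan a - Arctan b = Arctan (2 * of_real s * z / (z\<^sup>2 + 1))" .

  have "Ln ((1 + a) / (1 - a)) + Ln ((1 + b) / (1 - b)) =
      Ln ((1 + (a + b) + a * b) / (1 - (a + b) + a * b))"
    unfolding Ln_moebius_add[OF na nb] by (simp add: algebra_simps)
  also have "(1 + (a + b) + a * b) / (1 - (a + b) + a * b) =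
      (z\<^sup>2 * (1 + (a + b) + a * b)) / (z\<^sup>2 * (1 - (a + b) + a * b))"
    using z by simp
  also have "\<dots> = (z\<^sup>2 + 6 * of_real x * z + 1) / (z\<^sup>2 - 6 * of_real x * z + 1)"
    unfolding ab add using z by (simp add: algebra_simps power2_eq_square)
  finally have Ln_add: "Ln ((1 + a) / (1 - a)) + Ln ((1 + b) / (1 - b)) =
      Ln ((z\<^sup>2 + 6 * of_real x * z + 1) / (z\<^sup>2 - 6 * of_real x * z + 1))" .

  have "Arctan a + Arctan b = Arctan ((z\<^sup>2 * (a + b)) / (z\<^sup>2 * (1 - a * b)))"
    unfolding Arctan_add_disc[OF na nb] using z by simp
  also have "(z\<^sup>2 * (a + b)) / (z\<^sup>2 * (1 - a * b)) = 6 * of_real x * z / (z\<^sup>2 - 1)"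
    unfolding ab add using z by (simp add: algebra_simps power2_eq_square)
  finally have Arctan_add: "Arctan a + Arctan b = Arctan (6 * of_real x * z / (z\<^sup>2 - 1))" .

  \<comment> \<open>Dividing the Binet formula by \<open>z ^ n\<close> turns powers of the roots
    into powers of \<open>a\<close> and \<open>b\<close>; the prefactor \<open>1 / (2 * s)\<close>
    later yields the constants \<open>1 / (8 * s)\<close> and \<open>1 / (4 * s)\<close>.\<close>
  have B: "of_real (poly (balancing_poly n) x) / z ^ n = 1 / (2 * of_real s) * (a ^ n - b ^ n)" for n
  proof -
    have "poly (balancing_poly n) x = ((3 * x + s) ^ n - (3 * x - s) ^ n) / (2 * s)"
      using balancing_poly_Binet[OF s2, of n] s by (simp add: field_simps)
    thus ?thesis
      by (simp add: a_def b_def power_divide flip: diff_divide_distrib)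
  qed
  have C: "of_real (poly (lucas_balancing_poly n) x) / z ^ n = 1 / 2 * (a ^ n + b ^ n)" for n
  proof -
    have eq: "poly (lucas_balancing_poly n) x = ((3 * x + s) ^ n + (3 * x - s) ^ n) / 2"
      using lucas_balancing_poly_Binet[OF s2, of n] by simp
    show ?thesis
      unfolding eq by (simp add: a_def b_def power_divide flip: add_divide_distrib)
  qed

  note series = sums_power_4n_plus_3[OF na] sums_power_4n_plus_3[OF nb]
  have "(\<lambda>n. 1 / of_nat (4 * n + 3) * (of_real (poly (balancing_poly (4 * n + 3)) x) / z ^ (4 * n + 3)))
      sums (1 / (2 * of_real s) *
        (1 / 4 * (Ln ((1 + a) / (1 - a)) - Ln ((1 + b) / (1 - b))) - 1 / 2 * (Arctan a - Arctan b)))"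
    using sums_mult[OF sums_diff[OF series], of "1 / (2 * of_real s)"]
    unfolding B by (simp add: algebra_simps diff_divide_distrib)
  moreover have "(\<lambda>n. 1 / of_nat (4 * n + 3) *
      (of_real (poly (lucas_balancing_poly (4 * n + 3)) x) / z ^ (4 * n + 3)))
      sums (1 / 2 *
        (1 / 4 * (Ln ((1 + a) / (1 - a)) + Ln ((1 + b) / (1 - b))) - 1 / 2 * (Arctan a + Arctan b)))"
    using sums_mult[OF sums_add[OF series], of "1 / 2"]
    unfolding C by (simp add: algebra_simps add_divide_distrib)
  ultimately show ?thesis
    unfolding Ln_diff Arctan_diff Ln_add Arctan_add s_def[symmetric]
    by (simp add: right_diff_distrib)
qed

end
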